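(* Let $(G,d)$ be a $p$-uniformly convex space with constant $c>0$ that is symmetric perpendicular, and let $D\subseteq G$. For $i=1,2,\dots,n$ let $T_i:D\to G$ be pointwise $\alpha$-firmly nonexpansive with constant $\alpha_i$ at all points in $\bigcap_{i=1}^n\operatorname{Fix}T_i\neq\emptyset$ on $D$, and let $\omega_i\in[0,1]$ with $\sum_{i=1}^n\omega_i=1$. Then the mapping $\mathscr T$ defined by $$\mathscr Tx:=\operatorname*{argmin}_{y\in G}\sum_{i=1}^n\omega_i\,d(y,T_ix)^p$$ is pointwise $\alpha$-firmly nonexpansive at all $y\in\operatorname{Fix}\mathscr T$ on $D$ with constant $\alpha=\max_i\alpha_i$.
   Context: Let $p\in(1,\infty)$. A metric space $(G,d)$ is $p$-uniformly convex with constant $c>0$ if it is a geodesic space and for all $x,y,z\in G$, $t\in[0,1]$: $$d(z,(1-t)x\oplus ty)^p\le(1-t)d(z,x)^p+td(z,y)^p-\tfrac c2t(1-t)d(x,y)^p,$$ where $(1-t)x\oplus ty$ is the point on the (unique) geodesic joining $x$ and $y$ at distance $t\,d(x,y)$ from $x$. The minimizer defining $\mathscr Tx$ exists and is unique when the space is complete. $\operatorname{Fix}T=\{x:Tx=x\}$. Two geodesics $\gamma,\eta$ through a common point $q$: $\gamma$ is perpendicular to $\eta$ at $q$, written $\gamma\perp_q\eta$, if $d(x,q)\le d(x,y)$ for all $x\in\gamma$, $y\in\eta$. The space is symmetric perpendicular if for all geodesics $\gamma,\eta$ with common point $q$: $\gamma\perp_q\eta\iff\eta\perp_q\gamma$.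 $\psi_T^{(p,c)}(x,y)=\tfrac c2\left(d(Tx,x)^p+d(Ty,y)^p+d(Tx,Ty)^p+d(x,y)^p-d(Tx,y)^p-d(x,Ty)^p\right)$. A mapping $T$ is pointwise $\alpha$-firmly nonexpansive at $y\in D$ on $D$ with constant $\alpha\in(0,1)$ if $d(Tx,Ty)^p\le d(x,y)^p-\tfrac{1-\alpha}{\alpha}\psi_T^{(p,c)}(x,y)$ for all $x\in D$.
   Formalization: The formal theorem covers those y in Fix 𝒯 that are also fixed by every T_i with ω_i = 0 (no restriction if all ω_i > 0); without this the claim fails, e.g. on ℝ with p=c=2, ω=(1,0), T_1 x = 1 if x=1 and 0 otherwise, T_2=0, at y=1. *)

theory Defs
  imports "HOL-Analysis.Analysis"
begin

text \<open>
  A metric space \<open>(G, d)\<close> is given by a carrier set and a distance function, as in the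
  library locale \<^locale>\<open>Metric_space\<close>.
\<close>

text \<open>
  Geodesics are parametrised on the unit interval with constant speed, so that
  \<open>\<gamma> t\<close> is the point \<open>(1 - t) x \<oplus> t y\<close> at distance \<open>t d(x, y)\<close> from \<open>x\<close>.
\<close>

definition geodesic_path ::
  "'a set \<Rightarrow> ('a \<Rightarrow> 'a \<Rightarrow> real) \<Rightarrow> 'a \<Rightarrow> 'a \<Rightarrow> (real \<Rightarrow> 'a) \<Rightarrow> bool" where
  "geodesic_path G d x y \<gamma> \<longleftrightarrow>
     \<gamma> \<in> {0..1} \<rightarrow> G \<and> \<gamma> 0 = x \<and> \<gamma> 1 = y \<and>
     (\<forall>s\<in>{0..1}. \<forall>t\<in>{0..1}. d (\<gamma> s) (\<gamma> t) = \<bar>s - t\<bar> * d x y)"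

definition geodesic_space :: "'a set \<Rightarrow> ('a \<Rightarrow> 'a \<Rightarrow> real) \<Rightarrow> bool" where
  "geodesic_space G d \<longleftrightarrow> (\<forall>x\<in>G. \<forall>y\<in>G. \<exists>\<gamma>. geodesic_path G d x y \<gamma>)"

text \<open>
  The inequality is required along every geodesic. Since \<open>c > 0\<close> and \<open>p > 1\<close>, it implies that
  geodesics with given end points are unique, so uniqueness is not a separate requirement.
\<close>

definition p_uniformly_convex ::
  "'a set \<Rightarrow> ('a \<Rightarrow> 'a \<Rightarrow> real) \<Rightarrow> real \<Rightarrow> real \<Rightarrow> bool" where
  "p_uniformly_convex G d p c \<longleftrightarrow>
     geodesic_space G d \<and>
     (\<forall>x\<in>G. \<forall>y\<in>G. \<forall>z\<in>G. \<forall>\<gamma>. geodesic_path G d x y \<gamma> \<longrightarrow>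
        (\<forall>t\<in>{0..1}.
           d z (\<gamma> t) powr p \<le>
             (1 - t) * d z x powr p + t * d z y powr p
               - c / 2 * t * (1 - t) * d x y powr p))"

definition geodesic_segment :: "'a set \<Rightarrow> ('a \<Rightarrow> 'a \<Rightarrow> real) \<Rightarrow> 'a set \<Rightarrow> bool" where
  "geodesic_segment G d S \<longleftrightarrow>
     (\<exists>x\<in>G. \<exists>y\<in>G. \<exists>\<gamma>. geodesic_path G d x y \<gamma> \<and> S = \<gamma> ` {0..1})"

definition perpendicular_at :: "('a \<Rightarrow> 'a \<Rightarrow> real) \<Rightarrow> 'a \<Rightarrow> 'a set \<Rightarrow> 'a set \<Rightarrow> bool" where
  "perpendicular_at d q S R \<longleftrightarrow> (\<forall>x\<in>S. \<forall>y\<in>R. d x q \<le> d x y)"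

definition symmetric_perpendicular :: "'a set \<Rightarrow> ('a \<Rightarrow> 'a \<Rightarrow> real) \<Rightarrow> bool" where
  "symmetric_perpendicular G d \<longleftrightarrow>
     (\<forall>S R q. geodesic_segment G d S \<longrightarrow> geodesic_segment G d R \<longrightarrow> q \<in> S \<inter> R \<longrightarrow>
        (perpendicular_at d q S R \<longleftrightarrow> perpendicular_at d q R S))"

definition Fix :: "'a set \<Rightarrow> ('a \<Rightarrow> 'a) \<Rightarrow> 'a set" where
  "Fix D T = {x \<in> D. T x = x}"

definition psi ::
  "('a \<Rightarrow> 'a \<Rightarrow> real) \<Rightarrow> real \<Rightarrow> real \<Rightarrow> ('a \<Rightarrow> 'a) \<Rightarrow> 'a \<Rightarrow> 'a \<Rightarrow> real" where
  "psi d p c T x y =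
     c / 2 * (d (T x) x powr p + d (T y) y powr p + d (T x) (T y) powr p + d x y powr p
              - d (T x) y powr p - d x (T y) powr p)"

definition pointwise_firmly_nonexpansive ::
  "('a \<Rightarrow> 'a \<Rightarrow> real) \<Rightarrow> real \<Rightarrow> real \<Rightarrow> 'a set \<Rightarrow> real \<Rightarrow> ('a \<Rightarrow> 'a) \<Rightarrow> 'a \<Rightarrow> bool" where
  "pointwise_firmly_nonexpansive d p c D \<alpha> T y \<longleftrightarrow>
     y \<in> D \<and> 0 < \<alpha> \<and> \<alpha> < 1 \<and>
     (\<forall>x\<in>D. d (T x) (T y) powr p \<le> d x y powr p - (1 - \<alpha>) / \<alpha> * psi d p c T x y)"

text \<open>
  Pitfall: a map of weight zero does not influence the weighted mean \<open>\<T> x\<close> (the argmin of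
  \<open>\<Sum>i. \<omega> i * d y (T i x) powr p\<close> over \<open>y\<close>), whereas it does restrict the common fixed points at
  which the maps are assumed to be firmly nonexpansive. A fixed point of \<open>\<T>\<close> that some
  map of weight zero moves is therefore out of reach. For instance in \<open>\<real>\<close> with \<open>p = c = 2\<close>, take
  \<open>T 1 x = (if x = 1 then 1 else 0)\<close> with weight \<open>1\<close> and \<open>T 2 x = 0\<close> with weight \<open>0\<close>, both with
  constant \<open>1/2\<close>: then \<open>\<T> = T 1\<close> fixes \<open>1\<close> but is not firmly nonexpansive there (with \<open>x = 9/10\<close>).
  A claim about every fixed point of \<open>\<T>\<close> thus has to ask that maps of weight zero fix it as well;
  this is no restriction if all weights are positive.
\<close>

end

theory Submission
  imports Defs
begin

text \<open>
  At a fixed point \<open>y\<close> of \<open>T\<close>, firm nonexpansiveness says that \<open>T x\<close> lies in the convex set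
  \<open>C = {u. d(u,y)\<^sup>p + \<kappa> d(u,x)\<^sup>p \<le> d(x,y)\<^sup>p}\<close> with \<open>\<kappa> = (1 - \<alpha>) c / (2 \<alpha>)\<close>, and \<open>C\<close> grows with \<open>\<alpha>\<close>.
  In a symmetric perpendicular space, projecting a point \<open>z\<close> outside a convex set onto it brings \<open>z\<close>
  strictly closer to every point of the set, so the argmin \<open>\<T> x\<close> lies in every such \<open>C\<close> that contains all
  \<open>T\<^sub>i x\<close>. As the space need not be complete, an almost nearest point replaces the projection.

  A fixed point \<open>y\<close> of \<open>\<T>\<close> is a common fixed point: otherwise, for a common fixed point \<open>q\<close>, the points
  \<open>T\<^sub>i y \<noteq> y\<close> lie in a ball around \<open>q\<close> that misses \<open>y\<close>. Moving \<open>y\<close> by a small fraction \<open>t\<close> towards its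
  approximate projection decreases their part of the objective at least linearly in \<open>t\<close>, whereas the
  indices with \<open>T\<^sub>i y = y\<close> contribute only \<open>O(t\<^sup>p)\<close>.
\<close>

section \<open>Geodesics, their subsegments and convex sets\<close>

definition geodesically_convex :: "'a set \<Rightarrow> ('a \<Rightarrow> 'a \<Rightarrow> real) \<Rightarrow> 'a set \<Rightarrow> bool" where
  "geodesically_convex G d C \<longleftrightarrow>
     C \<subseteq> G \<and> (\<forall>x\<in>C. \<forall>y\<in>C. \<forall>\<gamma>. geodesic_path G d x y \<gamma> \<longrightarrow> \<gamma> \<in> {0..1} \<rightarrow> C)"

lemma geodesic_path_dist:
  assumes "geodesic_path G d x y \<gamma>" "s \<in> {0..1}" "t \<in> {0..1}"
  shows "d (\<gamma> s) (\<gamma> t) = \<bar>s - t\<bar> * d x y"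
  using assms by (auto simp: geodesic_path_def)

text \<open>The order of \<open>s\<close> and \<open>t\<close> is free, so the same
  reparametrisation also serves to run a geodesic backwards from an inner point to its
  start.\<close>

lemma geodesic_path_sub:
  assumes \<gamma>: "geodesic_path G d x y \<gamma>" and s: "s \<in> {0..1}" and t: "t \<in> {0..1}"
  shows "geodesic_path G d (\<gamma> s) (\<gamma> t) (\<lambda>r. \<gamma> (s + r * (t - s)))"
proof -
  have in01: "s + r * (t - s) \<in> {0..1}" if "r \<in> {0..1}" for r
  proof -
    have eq: "s + r * (t - s) = (1 - r) * s + r * t" by (simp add: algebra_simps)
    have "0 \<le> (1 - r) * s + r * t" using that s t by simp
    moreover have "(1 - r) * s + r * t \<le> 1"
      using that s t by (intro convex_bound_le) auto
    ultimately show ?thesis by (simp add: eq)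
  qed
  have G: "\<gamma> u \<in> G" if "u \<in> {0..1}" for u
    using \<gamma> that by (auto simp: geodesic_path_def)
  have "d (\<gamma> (s + u * (t - s))) (\<gamma> (s + v * (t - s))) = \<bar>u - v\<bar> * d (\<gamma> s) (\<gamma> t)"
    if u: "u \<in> {0..1}" and v: "v \<in> {0..1}" for u v
  proof -
    have "s + u * (t - s) - (s + v * (t - s)) = (u - v) * (t - s)" by (simp add: algebra_simps)
    then show ?thesis
      using geodesic_path_dist[OF \<gamma> in01[OF u] in01[OF v]] geodesic_path_dist[OF \<gamma> s t]
      by (simp add: abs_mult abs_minus_commute)
  qed
  then show ?thesis
    using G in01 unfolding geodesic_path_def by auto
qed

section \<open>Consequences of uniform convexity: sublevel sets, gap estimate, nearest points on
  geodesics\<close>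

locale p_convex_space = Metric_space G d for G :: "'a set" and d :: "'a \<Rightarrow> 'a \<Rightarrow> real" +
  fixes p c :: real
  assumes p_gt_1: "1 < p" and c_pos: "0 < c" and p_convex: "p_uniformly_convex G d p c"
begin

lemma geodesic_exists:
  assumes "x \<in> G" "y \<in> G"
  obtains \<gamma> where "geodesic_path G d x y \<gamma>"
  using assms p_convex unfolding p_uniformly_convex_def geodesic_space_def by blast

lemma powr_dist_geodesic_le:
  assumes "x \<in> G" "y \<in> G" "z \<in> G" "geodesic_path G d x y \<gamma>" "t \<in> {0..1}"
  shows "d z (\<gamma> t) powr p \<le> (1 - t) * d z x powr p + t * d z y powr p
           - c / 2 * t * (1 - t) * d x y powr p"
  using assms p_convex unfolding p_uniformly_convex_def by blast

lemma powr_dist_geodesic_le':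
  assumes "x \<in> G" "y \<in> G" "z \<in> G" "geodesic_path G d x y \<gamma>" "t \<in> {0..1}"
  shows "d z (\<gamma> t) powr p \<le> (1 - t) * d z x powr p + t * d z y powr p"
proof -
  have "0 \<le> c / 2 * t * (1 - t) * d x y powr p"
    using assms(5) c_pos by auto
  then show ?thesis using powr_dist_geodesic_le[OF assms] by linarith
qed

text \<open>Powers of distances are convex along geodesics, and a nonnegative combination stays
  convex. With \<open>k > 0\<close> these are the sets that describe firm nonexpansiveness; with
  \<open>k = 0\<close> they are balls around \<open>y\<close>.\<close>

lemma geodesically_convex_sublevel:
  assumes x: "x \<in> G" and y: "y \<in> G" and k: "0 \<le> k"
  shows "geodesically_convex G d {u \<in> G. d y u powr p + k * d x u powr p \<le> r}"
  unfolding geodesically_convex_def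
proof (intro conjI ballI allI impI Pi_I)
  let ?C = "{u \<in> G. d y u powr p + k * d x u powr p \<le> r}"
  fix u v \<gamma> t
  assume u: "u \<in> ?C" and v: "v \<in> ?C" and \<gamma>: "geodesic_path G d u v \<gamma>" and t: "t \<in> {0..1::real}"
  have uG: "u \<in> G" and vG: "v \<in> G" using u v by auto
  have "d y (\<gamma> t) powr p + k * d x (\<gamma> t) powr p \<le>
      ((1 - t) * d y u powr p + t * d y v powr p) + k * ((1 - t) * d x u powr p + t * d x v powr p)"
    using powr_dist_geodesic_le'[OF uG vG y \<gamma> t] powr_dist_geodesic_le'[OF uG vG x \<gamma> t] k
    by (intro add_mono mult_left_mono)
  also have "\<dots> = (1 - t) * (d y u powr p + k * d x u powr p) + t * (d y v powr p + k * d x v powr p)"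
    by (simp add: algebra_simps)
  also have "\<dots> \<le> r" using u v t by (intro convex_bound_le) auto
  finally show "\<gamma> t \<in> ?C"
    using \<gamma> t by (auto simp: geodesic_path_def)
qed auto

text \<open>A Pythagoras-type inequality. At \<open>t = 1/2\<close> uniform convexity has the
  deficit \<open>c / 8 * d x y powr p\<close>, which doubles when half of
  \<open>d z x powr p\<close> is absorbed on the left. Comparing \<open>x\<close> with the midpoint
  alone is enough.\<close>

lemma powr_dist_gap:
  assumes G: "x \<in> G" "y \<in> G" "z \<in> G" and \<gamma>: "geodesic_path G d x y \<gamma>"
    and le: "d z x \<le> d z (\<gamma> (1/2))"
  shows "d z x powr p + c / 4 * d x y powr p \<le> d z y powr p"
proof -
  have "d z x powr p \<le> d z (\<gamma> (1/2)) powr p"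
    using le p_gt_1 by (intro powr_mono2) auto
  also have "\<dots> \<le> (1 - 1/2) * d z x powr p + 1/2 * d z y powr p
           - c / 2 * (1/2) * (1 - 1/2) * d x y powr p"
    by (rule powr_dist_geodesic_le[OF G \<gamma>]) auto
  finally show ?thesis by (simp add: field_simps)
qed

text \<open>Compactness of the parameter interval provides a foot point on a single geodesic,
  whereas a convex set in an incomplete space may have no nearest point.\<close>

lemma geodesic_nearest_point:
  assumes z: "z \<in> G" and \<gamma>: "geodesic_path G d x y \<gamma>"
  obtains t where "t \<in> {0..1}" "\<And>s. s \<in> {0..1} \<Longrightarrow> d z (\<gamma> t) \<le> d z (\<gamma> s)"
proof -
  have G: "\<gamma> u \<in> G" if "u \<in> {0..1}" for u
    using \<gamma> that by (auto simp: geodesic_path_def)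
  have "(d x y)-lipschitz_on {0..1} (\<lambda>t. d z (\<gamma> t))"
  proof (rule lipschitz_onI)
    fix s t :: real assume st: "s \<in> {0..1}" "t \<in> {0..1}"
    have "\<bar>d z (\<gamma> s) - d z (\<gamma> t)\<bar> \<le> d (\<gamma> s) (\<gamma> t)"
      using triangle[OF z G[OF st(1)] G[OF st(2)]] triangle[OF z G[OF st(2)] G[OF st(1)]]
        commute[of "\<gamma> s" "\<gamma> t"] by linarith
    then show "dist (d z (\<gamma> s)) (d z (\<gamma> t)) \<le> d x y * dist s t"
      using geodesic_path_dist[OF \<gamma> st] by (simp add: dist_real_def mult.commute)
  qed simp
  then have "continuous_on {0..1} (\<lambda>t. d z (\<gamma> t))"
    by (rule lipschitz_on_continuous_on)
  then have "\<exists>t\<in>{0..1}. \<forall>s\<in>{0..1}. d z (\<gamma> t) \<le> d z (\<gamma> s)"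
    by (intro continuous_attains_inf) auto
  then show ?thesis using that by blast
qed

text \<open>Moving from \<open>z\<close> by less than \<open>e\<close> shortens each distance by
  less than \<open>e\<close>, and the defining expression depends continuously on this loss. So a
  point outside the set has positive distance from it.\<close>

lemma dist_bound_sublevel:
  assumes z: "z \<in> G" and x: "x \<in> G" and y: "y \<in> G" and k: "0 \<le> k"
    and gt: "r < d y z powr p + k * d x z powr p"
  obtains e where "0 < e"
    "\<forall>u \<in> {u \<in> G. d y u powr p + k * d x u powr p \<le> r}. e \<le> d z u"
proof -
  \<comment> \<open>Truncation at 0 keeps the bases nonnegative, as monotonicity and continuity of
    \<open>powr\<close> require.\<close>
  let ?h = "\<lambda>s. max 0 (d y z - s) powr p + k * max 0 (d x z - s) powr p"
  have "(?h \<longlongrightarrow> ?h 0) (at_right 0)"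
    using p_gt_1 by (intro tendsto_intros tendsto_powr2) (auto intro!: always_eventually)
  moreover have "?h 0 > r" using gt by simp
  ultimately have "\<forall>\<^sub>F s in at_right 0. r < ?h s"
    by (rule order_tendstoD)
  then have "\<forall>\<^sub>F s in at_right 0. r < ?h s \<and> 0 < s"
    using eventually_at_right_less by (rule eventually_conj)
  then obtain e where e: "r < ?h e" "0 < e"
    using eventually_happens' trivial_limit_at_right_real by blast
  show ?thesis
  proof (rule that[OF e(2)], rule ballI)
    fix u assume "u \<in> {u \<in> G. d y u powr p + k * d x u powr p \<le> r}"
    then have u: "u \<in> G" and le: "d y u powr p + k * d x u powr p \<le> r" by auto
    show "e \<le> d z u"
    proof (rule ccontr)
      assume "\<not> e \<le> d z u"
      then have "d y z - e \<le> d y u" "d x z - e \<le> d x u"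
        using triangle[OF y u z] triangle[OF x u z] commute[of u z] by linarith+
      then have "?h e \<le> d y u powr p + k * d x u powr p"
        using p_gt_1 k by (intro add_mono mult_left_mono powr_mono2) auto
      then show False using e(1) le by linarith
    qed
  qed
qed

end

section \<open>Symmetric perpendicularity and approximate projection\<close>

locale symmetric_p_convex_space = p_convex_space +
  assumes symmetric: "symmetric_perpendicular G d"
begin

text \<open>By the triangle inequality, a foot \<open>w\<close> of \<open>z\<close> on
  \<open>\<gamma>\<close> is also a foot of every point between \<open>w\<close> and
  \<open>z\<close>. So \<open>\<eta>\<close> is perpendicular to \<open>\<gamma>\<close> at
  \<open>w\<close>, and symmetry exchanges the two geodesics.\<close>

lemma foot_is_nearest:
  assumes z: "z \<in> G" and a: "a \<in> G" and w: "w \<in> G"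
    and \<gamma>: "geodesic_path G d w a \<gamma>" and \<eta>: "geodesic_path G d w z \<eta>"
    and min: "\<And>s. s \<in> {0..1} \<Longrightarrow> d z w \<le> d z (\<gamma> s)"
    and r: "r \<in> {0..1}"
  shows "d a w \<le> d a (\<eta> r)"
proof -
  let ?S = "\<eta> ` {0..1}" and ?R = "\<gamma> ` {0..1}"
  have ends: "\<gamma> 0 = w" "\<gamma> 1 = a" "\<eta> 0 = w" "\<eta> 1 = z"
    using \<gamma> \<eta> by (auto simp: geodesic_path_def)
  have G: "\<gamma> u \<in> G" "\<eta> u \<in> G" if "u \<in> {0..1}" for u
    using \<gamma> \<eta> that by (auto simp: geodesic_path_def)
  have seg: "geodesic_segment G d ?S" "geodesic_segment G d ?R"
    using \<gamma> \<eta> z a w unfolding geodesic_segment_def by blast+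
  have zero: "(0::real) \<in> {0..1}" and one: "(1::real) \<in> {0..1}" by auto
  have "w \<in> ?S \<inter> ?R"
    using ends zero by (metis IntI image_eqI)
  moreover have "perpendicular_at d w ?S ?R"
    unfolding perpendicular_at_def
  proof safe
    fix u v :: real assume u: "u \<in> {0..1}" and v: "v \<in> {0..1}"
    have "d w z = d w (\<eta> u) + d (\<eta> u) z"
      using geodesic_path_dist[OF \<eta> zero u] geodesic_path_dist[OF \<eta> u one] ends u
      by (simp add: algebra_simps)
    moreover have "d z (\<gamma> v) \<le> d z (\<eta> u) + d (\<eta> u) (\<gamma> v)"
      using triangle z G u v by blast
    ultimately show "d (\<eta> u) w \<le> d (\<eta> u) (\<gamma> v)"
      using min[OF v] commute[of z w] commute[of z "\<eta> u"] commute[of w "\<eta> u"] by linarith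
  qed
  ultimately have "perpendicular_at d w ?R ?S"
    using symmetric seg unfolding symmetric_perpendicular_def by blast
  moreover have "a \<in> ?R" using ends(2) one by (metis image_eqI)
  ultimately show ?thesis
    using r unfolding perpendicular_at_def by blast
qed

text \<open>Let \<open>w\<close> be almost nearest to \<open>z\<close> in \<open>C\<close>. For each
  \<open>a\<close>, the foot of \<open>z\<close> on the geodesic from \<open>w\<close> to
  \<open>a\<close> is closer to \<open>a\<close> than \<open>z\<close> is, by an amount independent
  of \<open>w\<close>, and it lies within \<open>h\<close> of \<open>w\<close>. As \<open>A\<close>
  is finite, one \<open>h\<close> can be chosen smaller than all these gains.\<close>

lemma nearer_point_exists:
  assumes C: "geodesically_convex G d C" "C \<noteq> {}" and z: "z \<in> G"
    and e: "0 < e" "\<forall>u\<in>C. e \<le> d z u"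
    and A: "finite A" "A \<subseteq> C"
  obtains w where "w \<in> C" "\<forall>a\<in>A. d a w < d a z"
proof -
  have CG: "u \<in> G" if "u \<in> C" for u
    using C that by (auto simp: geodesically_convex_def)
  define R where "R = (INF u\<in>C. d z u powr p)"
  have bdd: "bdd_below ((\<lambda>u. d z u powr p) ` C)"
    by (rule bdd_belowI2[of _ 0]) auto
  have R_le: "R \<le> d z u powr p" if "u \<in> C" for u
    unfolding R_def using bdd that by (rule cINF_lower)
  have "e powr p \<le> R"
    unfolding R_def using C(2) e p_gt_1 by (intro cINF_greatest powr_mono2) auto
  then have R_pos: "0 < R" using e(1) by (smt (verit) powr_gt_zero)
  \<comment> \<open>This will bound the distance from \<open>a\<close> to the foot of
    \<open>z\<close> on the geodesic from \<open>w\<close> to \<open>a\<close>.\<close>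
  define B where "B a = (d a z powr p - c / 4 * R) powr (1/p)" for a
  have B_bound: "B a < d a z" if aA: "a \<in> A" and ineq: "c / 4 * R \<le> d a z powr p" for a
  proof -
    have "B a < (d a z powr p) powr (1/p)"
      unfolding B_def using ineq R_pos c_pos p_gt_1 by (intro powr_less_mono2) auto
    also have "\<dots> = d a z" using p_gt_1 by (simp add: powr_powr)
    finally show ?thesis .
  qed
  \<comment> \<open>The element 1 and the filter make \<open>h\<close> positive before
    \<open>B a < d a z\<close> is known; that inequality follows for every \<open>a\<close> in
    \<open>A\<close> once a foot has been constructed.\<close>
  define h where "h = Min (insert 1 ((\<lambda>a. d a z - B a) ` {a\<in>A. B a < d a z})) / 2"
  have h_pos: "0 < h" using A(1) by (simp add: h_def)
  have h_less: "B a + h < d a z" if "a \<in> A" "B a < d a z" for a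
  proof -
    have "2 * h \<le> d a z - B a" unfolding h_def using A(1) that by (auto intro!: Min_le)
    then show ?thesis using h_pos by linarith
  qed
  \<comment> \<open>The margin is the gap of \<open>powr_dist_gap\<close> at distance
    \<open>h\<close>, so that the foot ends up closer than \<open>h\<close> to
    \<open>w\<close>.\<close>
  have "R < R + c / 4 * h powr p" using c_pos h_pos by simp
  then obtain w where w: "w \<in> C" "d z w powr p < R + c / 4 * h powr p"
    using cINF_less_iff[OF C(2) bdd] unfolding R_def by blast
  show ?thesis
  proof (rule that[OF w(1)], rule ballI)
    fix a assume a: "a \<in> A"
    then have aC: "a \<in> C" using A(2) by auto
    obtain \<gamma> where \<gamma>: "geodesic_path G d w a \<gamma>"
      using geodesic_exists CG w(1) aC by blast
    have \<gamma>C: "\<gamma> u \<in> C" if "u \<in> {0..1}" for u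
      using C(1) w(1) aC \<gamma> that unfolding geodesically_convex_def by blast
    have ends: "\<gamma> 0 = w" "\<gamma> 1 = a" using \<gamma> by (auto simp: geodesic_path_def)
    obtain t where t: "t \<in> {0..1}" and min: "\<And>s. s \<in> {0..1} \<Longrightarrow> d z (\<gamma> t) \<le> d z (\<gamma> s)"
      using geodesic_nearest_point[OF z \<gamma>] by blast
    let ?v = "\<gamma> t"
    have v: "?v \<in> C" "?v \<in> G" using \<gamma>C CG t by auto
    \<comment> \<open>This runs back from the foot to \<open>w\<close>. The foot is nearest to
      \<open>z\<close> on it and \<open>w\<close> is almost nearest in \<open>C\<close>, so the gap
      estimate keeps the two close.\<close>
    have "geodesic_path G d ?v w (\<lambda>r. \<gamma> (t + r * (0 - t)))"
      using geodesic_path_sub[OF \<gamma> t, of 0] ends by simp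
    then have "d z ?v powr p + c / 4 * d ?v w powr p \<le> d z w powr p"
      by (rule powr_dist_gap[OF v(2) CG[OF w(1)] z]) (use t in \<open>auto intro!: min\<close>)
    then have "c / 4 * d ?v w powr p < c / 4 * h powr p"
      using w(2) R_le[OF v(1)] by linarith
    then have "d ?v w powr p < h powr p" using c_pos by simp
    then have vw: "d ?v w < h"
      using h_pos p_gt_1 by (meson not_less powr_mono2 less_imp_le order_trans zero_less_one)
    have sub: "geodesic_path G d ?v a (\<lambda>r. \<gamma> (t + r * (1 - t)))"
      using geodesic_path_sub[OF \<gamma> t, of 1] ends by simp
    obtain \<eta> where \<eta>: "geodesic_path G d ?v z \<eta>"
      using geodesic_exists v z by blast
    have "d a ?v \<le> d a (\<eta> (1/2))"
    proof (rule foot_is_nearest[OF z CG[OF aC] v(2) sub \<eta>])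
      fix s :: real assume s: "s \<in> {0..1}"
      have "t + s * (1 - t) = (1 - s) * t + s * 1" by (simp add: algebra_simps)
      moreover have "(1 - s) * t + s * 1 \<le> 1"
        using s t by (intro convex_bound_le) auto
      ultimately have "t + s * (1 - t) \<in> {0..1}" using s t by auto
      then show "d z ?v \<le> d z (\<gamma> (t + s * (1 - t)))" by (rule min)
    qed auto
    \<comment> \<open>The second use of the gap estimate has the roles exchanged: now
      \<open>?v\<close> is compared with \<open>z\<close> as seen from \<open>a\<close>. The gap is
      at least \<open>c / 4 * R\<close> because \<open>?v\<close> lies in \<open>C\<close>.\<close>
    then have "d a ?v powr p + c / 4 * d ?v z powr p \<le> d a z powr p"
      by (rule powr_dist_gap[OF v(2) z CG[OF aC] \<eta>])
    moreover have "c / 4 * R \<le> c / 4 * d ?v z powr p"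
      using R_le[OF v(1)] c_pos commute[of z ?v] by simp
    ultimately have le: "d a ?v powr p \<le> d a z powr p - c / 4 * R" by linarith
    have "0 \<le> d a ?v powr p" by simp
    then have "c / 4 * R \<le> d a z powr p" using le by linarith
    then have B: "B a < d a z" by (rule B_bound[OF a])
    have "d a ?v = (d a ?v powr p) powr (1/p)" using p_gt_1 by (simp add: powr_powr)
    also have "\<dots> \<le> B a"
      unfolding B_def using le p_gt_1 by (intro powr_mono2) auto
    finally have "d a ?v \<le> B a" .
    moreover have "d a w \<le> d a ?v + d ?v w"
      using triangle CG aC v w by blast
    ultimately show "d a w < d a z" using vw h_less[OF a B] by linarith
  qed
qed

section \<open>Minimizers of weighted sums of distance powers\<close>

lemma argmin_in_sublevel:
  assumes x: "x \<in> G" and y: "y \<in> G" and k: "0 \<le> k"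
    and I: "finite I" and w0: "\<And>i. i \<in> I \<Longrightarrow> 0 \<le> \<omega> i" and wpos: "\<exists>i\<in>I. 0 < \<omega> i"
    and a: "\<And>i. i \<in> I \<Longrightarrow> a i \<in> G \<and> d y (a i) powr p + k * d x (a i) powr p \<le> r"
    and argmin: "is_arg_min (\<lambda>u. \<Sum>i\<in>I. \<omega> i * d u (a i) powr p) (\<lambda>u. u \<in> G) z"
  shows "d y z powr p + k * d x z powr p \<le> r"
proof (rule ccontr)
  assume "\<not> ?thesis"
  then have gt: "r < d y z powr p + k * d x z powr p" by simp
  have z: "z \<in> G" using argmin by (auto simp: is_arg_min_def)
  let ?C = "{u \<in> G. d y u powr p + k * d x u powr p \<le> r}"
  obtain e where e: "0 < e" "\<forall>u\<in>?C. e \<le> d z u"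
    by (rule dist_bound_sublevel[OF z x y k gt])
  have sub: "a ` I \<subseteq> ?C" using a by auto
  then have ne: "?C \<noteq> {}" using wpos by blast
  obtain w where w: "w \<in> ?C" "\<forall>u \<in> a ` I. d u w < d u z"
    by (rule nearer_point_exists[OF geodesically_convex_sublevel[OF x y k] ne z e
        finite_imageI[OF I] sub])
  have less: "d w (a i) powr p < d z (a i) powr p" if "i \<in> I" for i
    using w(2) that p_gt_1 commute[of w "a i"] commute[of z "a i"]
    by (intro powr_less_mono2) auto
  have "(\<Sum>i\<in>I. \<omega> i * d w (a i) powr p) < (\<Sum>i\<in>I. \<omega> i * d z (a i) powr p)"
  proof (rule sum_strict_mono_ex1[OF I])
    show "\<forall>i\<in>I. \<omega> i * d w (a i) powr p \<le> \<omega> i * d z (a i) powr p"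
      using w0 by (intro ballI mult_left_mono less_imp_le[OF less]) auto
    show "\<exists>i\<in>I. \<omega> i * d w (a i) powr p < \<omega> i * d z (a i) powr p"
      using wpos less by (metis mult_strict_left_mono)
  qed
  then show False using argmin w(1) by (auto simp: is_arg_min_def)
qed

text \<open>The points \<open>a i\<close> equal to \<open>y\<close> lie outside the ball that holds
  the others, so a full jump to a nearer point could raise the sum. A short step works: the gain is
  of first order in its length and the loss of order \<open>p > 1\<close>.\<close>

lemma argmin_at_vertex:
  assumes q: "q \<in> G" and y: "y \<in> G"
    and I: "finite I" and w0: "\<And>i. i \<in> I \<Longrightarrow> 0 \<le> \<omega> i"
    and a: "\<And>i. i \<in> I \<Longrightarrow> a i \<in> G" and less: "\<And>i. i \<in> I \<Longrightarrow> a i \<noteq> y \<Longrightarrow> d q (a i) < d q y"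
    and argmin: "is_arg_min (\<lambda>u. \<Sum>i\<in>I. \<omega> i * d u (a i) powr p) (\<lambda>u. u \<in> G) y"
    and i: "i \<in> I" "0 < \<omega> i"
  shows "a i = y"
proof (rule ccontr)
  assume ne: "a i \<noteq> y"
  let ?J = "{j \<in> I. a j \<noteq> y}"
  have J: "finite ?J" "i \<in> ?J" using I i ne by auto
  define \<rho> where "\<rho> = Max ((\<lambda>j. d q (a j)) ` ?J)"
  have "\<rho> \<in> (\<lambda>j. d q (a j)) ` ?J" unfolding \<rho>_def using J by (intro Max_in) auto
  then have \<rho>: "\<rho> < d q y" "0 \<le> \<rho>" using less by auto
  have \<rho>_ge: "d q (a j) \<le> \<rho>" if "j \<in> ?J" for j
    unfolding \<rho>_def using J that by (intro Max_ge) auto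
  \<comment> \<open>The ball of radius \<open>\<rho>\<close> around \<open>q\<close>, written with
    \<open>k = 0\<close> to fit the sublevel lemmas.\<close>
  let ?C = "{u \<in> G. d q u powr p + 0 * d q u powr p \<le> \<rho> powr p}"
  have "\<rho> powr p < d q y powr p + 0 * d q y powr p"
    using \<rho> p_gt_1 by (simp add: powr_less_mono2)
  then obtain e where e: "0 < e" "\<forall>u\<in>?C. e \<le> d y u"
    by (rule dist_bound_sublevel[OF y q q order_refl])
  have sub: "a ` ?J \<subseteq> ?C"
    using a \<rho>_ge p_gt_1 by (auto intro!: powr_mono2)
  then have ne': "?C \<noteq> {}" using J by blast
  obtain w where w: "w \<in> ?C" "\<forall>u \<in> a ` ?J. d u w < d u y"
    by (rule nearer_point_exists[OF geodesically_convex_sublevel[OF q q order_refl] ne' y e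
        finite_imageI[OF J(1)] sub])
  have wG: "w \<in> G" using w by auto
  have closer: "d w (a j) powr p < d y (a j) powr p" if "j \<in> ?J" for j
    using w(2) that p_gt_1 commute[of w "a j"] commute[of y "a j"]
    by (intro powr_less_mono2) auto
  let ?F = "\<lambda>K u. \<Sum>j\<in>K. \<omega> j * d u (a j) powr p"
  define \<delta> where "\<delta> = ?F ?J y - ?F ?J w"
  have "?F ?J w < ?F ?J y"
  proof (rule sum_strict_mono_ex1[OF J(1)])
    show "\<forall>j\<in>?J. \<omega> j * d w (a j) powr p \<le> \<omega> j * d y (a j) powr p"
      using w0 by (intro ballI mult_left_mono less_imp_le[OF closer]) auto
    show "\<exists>j\<in>?J. \<omega> j * d w (a j) powr p < \<omega> j * d y (a j) powr p"
      using J(2) i closer by (intro bexI[of _ i]) auto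
  qed
  then have \<delta>: "0 < \<delta>" by (simp add: \<delta>_def)
  \<comment> \<open>After a step of fraction \<open>t\<close> towards \<open>w\<close>, the indices
    with \<open>a j = y\<close> cost exactly \<open>K * t powr p\<close>, while convexity makes the
    others gain at least \<open>t * \<delta>\<close>.\<close>
  define K where "K = (\<Sum>j\<in>I - ?J. \<omega> j) * d y w powr p"
  obtain \<gamma> where \<gamma>: "geodesic_path G d y w \<gamma>" using geodesic_exists y wG by blast
  have \<gamma>0: "\<gamma> 0 = y" using \<gamma> by (simp add: geodesic_path_def)
  have split: "?F I u = ?F ?J u + ?F (I - ?J) u" for u
    using sum.subset_diff[of ?J I "\<lambda>j. \<omega> j * d u (a j) powr p"] I by auto
  have bound: "\<delta> \<le> K * t powr (p - 1)" if t: "0 < t" "t < 1" for t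
  proof -
    have t01: "t \<in> {0..1}" using t by auto
    have gG: "\<gamma> t \<in> G" using \<gamma> t01 by (auto simp: geodesic_path_def)
    have "?F ?J (\<gamma> t) \<le> (\<Sum>j\<in>?J. (1 - t) * (\<omega> j * d y (a j) powr p) + t * (\<omega> j * d w (a j) powr p))"
    proof (rule sum_mono)
      fix j assume "j \<in> ?J"
      then have j: "a j \<in> G" "0 \<le> \<omega> j" using a w0 by auto
      have "d (\<gamma> t) (a j) powr p \<le> (1 - t) * d y (a j) powr p + t * d w (a j) powr p"
        using powr_dist_geodesic_le'[OF y wG j(1) \<gamma> t01] by (simp add: commute)
      from mult_left_mono[OF this j(2)]
      show "\<omega> j * d (\<gamma> t) (a j) powr p \<le>
          (1 - t) * (\<omega> j * d y (a j) powr p) + t * (\<omega> j * d w (a j) powr p)"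
        by (simp add: algebra_simps)
    qed
    also have "\<dots> = (1 - t) * ?F ?J y + t * ?F ?J w"
      by (simp add: sum.distrib sum_distrib_left)
    also have "\<dots> = ?F ?J y - t * \<delta>" by (simp add: \<delta>_def algebra_simps)
    finally have 1: "?F ?J (\<gamma> t) \<le> ?F ?J y - t * \<delta>" .
    have "d (\<gamma> t) y = t * d y w"
      using geodesic_path_dist[OF \<gamma> t01, of 0] \<gamma>0 t by simp
    then have "?F (I - ?J) (\<gamma> t) = (\<Sum>j\<in>I - ?J. \<omega> j * (t powr p * d y w powr p))"
      using t by (intro sum.cong) (auto simp: powr_mult)
    also have "\<dots> = K * t powr p" by (simp only: K_def mult.assoc mult.commute[of "t powr p"] sum_distrib_right[symmetric])
    finally have 2: "?F (I - ?J) (\<gamma> t) = K * t powr p" .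
    have 3: "?F (I - ?J) y = 0" using y by (intro sum.neutral) auto
    have "?F I y \<le> ?F I (\<gamma> t)" using argmin gG by (auto simp: is_arg_min_linorder)
    then have "t * \<delta> \<le> K * t powr p" using 1 2 3 split[of y] split[of "\<gamma> t"] by linarith
    also have "t powr p = t * t powr (p - 1)"
      using t powr_mult_base[of t "p - 1"] by simp
    finally have "t * \<delta> \<le> t * (K * t powr (p - 1))" by (simp add: algebra_simps)
    then show ?thesis using t by simp
  qed
  \<comment> \<open>The exponent \<open>p - 1\<close> is positive, so letting \<open>t\<close> tend
    to 0 in \<open>bound\<close> contradicts \<open>0 < \<delta>\<close>.\<close>
  have "((\<lambda>t. K * t powr (p - 1)) \<longlongrightarrow> K * 0 powr (p - 1)) (at_right 0)"
    using p_gt_1 by (intro tendsto_intros tendsto_powr2) (auto simp: eventually_at_filter)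
  then have lim: "((\<lambda>t. K * t powr (p - 1)) \<longlongrightarrow> 0) (at_right 0)" by simp
  have "\<forall>\<^sub>F t::real in at_right 0. 0 < t \<and> t < 1"
    unfolding eventually_at_right_field by (intro exI[of _ 1]) auto
  then have "\<forall>\<^sub>F t in at_right 0. \<delta> \<le> K * t powr (p - 1)"
    by eventually_elim (use bound in auto)
  then have "\<delta> \<le> 0" by (intro tendsto_lowerbound[OF lim]) auto
  then show False using \<delta> by simp
qed

end

section \<open>Firm nonexpansiveness at fixed points and the theorem\<close>

lemma pointwise_firmly_nonexpansive_at_fixpoint:
  assumes "Metric_space G d" "0 < p" "y \<in> D" "y \<in> G" "T y = y"
  shows "pointwise_firmly_nonexpansive d p c D \<alpha> T y \<longleftrightarrow> 0 < \<alpha> \<and> \<alpha> < 1 \<and>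
     (\<forall>x\<in>D. d y (T x) powr p + (1 - \<alpha>) / \<alpha> * (c / 2) * d x (T x) powr p \<le> d y x powr p)"
proof -
  interpret Metric_space G d by fact
  \<comment> \<open>With \<open>T y = y\<close> the mixed terms cancel and only the displacement of
    \<open>x\<close> remains.\<close>
  have psi: "psi d p c T x y = c / 2 * d x (T x) powr p" for x
    using assms by (simp add: psi_def commute[of "T x" x])
  then show ?thesis
    using assms
    by (simp add: pointwise_firmly_nonexpansive_def psi commute[of _ y] le_diff_eq mult.assoc)
qed

theorem theorem21:
  fixes G D :: "'a set"
    and d :: "'a \<Rightarrow> 'a \<Rightarrow> real"
    and p c :: real
    and n :: nat
    and T :: "nat \<Rightarrow> 'a \<Rightarrow> 'a"
    and \<alpha> \<omega> :: "nat \<Rightarrow> real"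
    and TT :: "'a \<Rightarrow> 'a"
  assumes "Metric_space G d"
    and "1 < p" and "0 < c"
    and "p_uniformly_convex G d p c"
    and "symmetric_perpendicular G d"
    and "D \<subseteq> G"
    and "\<And>i. i \<in> {1..n} \<Longrightarrow> T i \<in> D \<rightarrow> G"
    and "(\<Inter>i\<in>{1..n}. Fix D (T i)) \<noteq> {}"
    and "\<And>i y. i \<in> {1..n} \<Longrightarrow> y \<in> (\<Inter>j\<in>{1..n}. Fix D (T j)) \<Longrightarrow>
           pointwise_firmly_nonexpansive d p c D (\<alpha> i) (T i) y"
    and "\<And>i. i \<in> {1..n} \<Longrightarrow> \<omega> i \<in> {0..1}"
    and "(\<Sum>i=1..n. \<omega> i) = 1"
    and "\<And>x. x \<in> D \<Longrightarrow>
           is_arg_min (\<lambda>y. \<Sum>i=1..n. \<omega> i * d y (T i x) powr p) (\<lambda>y. y \<in> G) (TT x)"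
  shows "\<forall>y \<in> Fix D TT. (\<forall>i\<in>{1..n}. \<omega> i = 0 \<longrightarrow> y \<in> Fix D (T i)) \<longrightarrow>
           pointwise_firmly_nonexpansive d p c D (Max (\<alpha> ` {1..n})) TT y"
proof (intro ballI impI)
  fix y assume y: "y \<in> Fix D TT" and fixed0: "\<forall>i\<in>{1..n}. \<omega> i = 0 \<longrightarrow> y \<in> Fix D (T i)"
  interpret symmetric_p_convex_space G d p c
    using assms(1-5) by (simp add: symmetric_p_convex_space_def p_convex_space_def
        p_convex_space_axioms_def symmetric_p_convex_space_axioms_def)
  have yD: "y \<in> D" and yT: "TT y = y" using y by (auto simp: Fix_def)
  have DG: "x \<in> G" if "x \<in> D" for x using that assms(6) by blast
  have TG: "T i x \<in> G" if "i \<in> {1..n}" "x \<in> D" for i x using assms(7) that by blast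
  have w0: "0 \<le> \<omega> i" if "i \<in> {1..n}" for i using assms(10)[OF that] by simp
  have wpos: "\<exists>i\<in>{1..n}. 0 < \<omega> i"
    using assms(11) sum_nonpos[of "{1..n}" \<omega>] by (force simp: not_less)
  have p0: "0 < p" using p_gt_1 by simp
  have firm: "0 < \<alpha> i" "\<alpha> i < 1"
      "d q (T i x) powr p + (1 - \<alpha> i) / \<alpha> i * (c / 2) * d x (T i x) powr p \<le> d q x powr p"
    if i: "i \<in> {1..n}" and q: "q \<in> (\<Inter>j\<in>{1..n}. Fix D (T j))" and x: "x \<in> D" for i q x
  proof -
    have "q \<in> D" "T i q = q" using i q by (auto simp: Fix_def)
    then have "0 < \<alpha> i \<and> \<alpha> i < 1 \<and> (\<forall>x\<in>D. d q (T i x) powr p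
        + (1 - \<alpha> i) / \<alpha> i * (c / 2) * d x (T i x) powr p \<le> d q x powr p)"
      using assms(9)[OF i q] pointwise_firmly_nonexpansive_at_fixpoint[OF assms(1) p0 _ DG] by blast
    then show "0 < \<alpha> i" "\<alpha> i < 1"
      "d q (T i x) powr p + (1 - \<alpha> i) / \<alpha> i * (c / 2) * d x (T i x) powr p \<le> d q x powr p"
      using x by auto
  qed
  obtain q where q: "q \<in> (\<Inter>j\<in>{1..n}. Fix D (T j))" using assms(8) by blast
  \<comment> \<open>\<open>wpos\<close> makes the index set nonempty; an empty intersection would be
    the whole type and would not place \<open>q\<close> in \<open>D\<close>.\<close>
  have qG: "q \<in> G" using q wpos DG by (auto simp: Fix_def)
  have "T i y = y" if i: "i \<in> {1..n}" for i
  proof (cases "\<omega> i = 0")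
    case True
    then have "y \<in> Fix D (T i)" using fixed0 i by blast
    then show ?thesis by (simp add: Fix_def)
  next
    case False
    then have "0 < \<omega> i" using w0[OF i] by simp
    then show ?thesis
    proof (rule argmin_at_vertex[OF qG DG[OF yD] _ w0 TG[OF _ yD] _ _ i, rotated -1])
      fix j assume j: "j \<in> {1..n}" and ne: "T j y \<noteq> y"
      \<comment> \<open>If \<open>T j\<close> moves \<open>y\<close>, the displacement term in the
        inequality at the common fixed point \<open>q\<close> is positive, so \<open>T j y\<close>
        is strictly closer to \<open>q\<close> than \<open>y\<close> is.\<close>
      have "0 < (1 - \<alpha> j) / \<alpha> j * (c / 2) * d y (T j y) powr p"
        using firm(1,2)[OF j q yD] c_pos ne DG[OF yD] TG[OF j yD] by auto
      then have "d q (T j y) powr p < d q y powr p"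
        using firm(3)[OF j q yD] by linarith
      then show "d q (T j y) < d q y"
        using p0 by (meson not_less powr_mono2 less_imp_le nonneg)
    qed (use assms(12)[OF yD] yT in auto)
  qed
  then have yFix: "y \<in> (\<Inter>j\<in>{1..n}. Fix D (T j))" using yD by (auto simp: Fix_def)
  define A where "A = Max (\<alpha> ` {1..n})"
  have "A \<in> \<alpha> ` {1..n}" unfolding A_def using wpos by (intro Max_in) auto
  then have A: "0 < A" "A < 1" using firm(1,2)[OF _ q yD] by auto
  have A_ge: "\<alpha> i \<le> A" if "i \<in> {1..n}" for i
    unfolding A_def using that by (intro Max_ge) auto
  let ?k = "(1 - A) / A * (c / 2)"
  have k: "0 \<le> ?k" using A c_pos by simp
  have "d y (TT x) powr p + ?k * d x (TT x) powr p \<le> d y x powr p" if x: "x \<in> D" for x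
  proof (rule argmin_in_sublevel[OF DG[OF x] DG[OF yD] k _ w0 wpos _ assms(12)[OF x]])
    fix i assume i: "i \<in> {1..n}"
    \<comment> \<open>\<open>(1 - a) / a\<close> decreases in \<open>a\<close> on the unit interval,
      so the largest constant gives the weakest inequality, which all \<open>T i\<close>
      share.\<close>
    have "(1 - A) / A \<le> (1 - \<alpha> i) / \<alpha> i"
      using A A_ge[OF i] firm(1,2)[OF i q yD] by (intro frac_le) auto
    then have "?k * d x (T i x) powr p \<le> (1 - \<alpha> i) / \<alpha> i * (c / 2) * d x (T i x) powr p"
      using c_pos by (intro mult_right_mono) auto
    then show "T i x \<in> G \<and> d y (T i x) powr p + ?k * d x (T i x) powr p \<le> d y x powr p"
      using firm(3)[OF i yFix x] TG[OF i x] by linarith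
  qed auto
  then have "pointwise_firmly_nonexpansive d p c D A TT y"
    using A pointwise_firmly_nonexpansive_at_fixpoint[of G d p y D TT c A, OF assms(1) p0 yD DG[OF yD] yT]
    by blast
  then show "pointwise_firmly_nonexpansive d p c D (Max (\<alpha> ` {1..n})) TT y"
    by (simp only: A_def)
qed

end
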